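(* For $n\ge 2$, let $a_1,\dots,a_n\in\mathbb{C}^*=\mathbb{C}\setminus\{0\}$, let $k_1,\dots,k_n$ be integers with $1<k_1<k_2$ and $k_2\le\cdots\le k_n$, and let $$X=\{x\in\mathbb{C}^n\mid a_1x_1^{k_1}+\cdots+a_nx_n^{k_n}=0\}$$ be the corresponding Pham-Brieskorn hypersurface germ at the origin. Then $X$ is not normally embedded at the origin.
   Context: On a locally closed path-connected set $Y\subset\mathbb{R}^N$ (here $\mathbb{C}^n\cong\mathbb{R}^{2n}$) consider the outer metric $d(x,y)=\|x-y\|$ (Euclidean) and the inner metric $d_Y(x,y)$, the infimum of the lengths of arcs in $Y$ joining $x$ and $y$. $Y$ is (Lipschitz) normally embedded if there is a constant $C>0$ with $d_Y(x,y)\le C\,d(x,y)$ for all $x,y\in Y$. A set $Y$ is normally embedded at $x\in Y$ if for some neighbourhood $U$ of $x$ the set $U\cap Y$ is normally embedded. *)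

theory Defs
  imports "HOL-Analysis.Analysis"
begin

text \<open>Length of a path on \<^term>\<open>{0..1::real}\<close>: the supremum of the lengths of inscribed
  polygons, infinite if the path is not rectifiable.\<close>

definition curve_length :: "(real \<Rightarrow> 'a::metric_space) \<Rightarrow> ennreal" where
  "curve_length g =
     (SUP (m, t) \<in> {(m :: nat, t :: nat \<Rightarrow> real). mono_on {..m} t \<and> t ` {..m} \<subseteq> {0..1}}.
        \<Sum>i<m. ennreal (dist (g (t i)) (g (t (Suc i)))))"

text \<open>The infimum runs over all continuous paths in \<open>Y\<close>, not only over injective ones: this gives
  the same value for distinct points, and it gives \<open>0\<close> for \<open>x = y \<in> Y\<close>, where there is no
  injective path. Points that no rectifiable path in \<open>Y\<close> joins are at infinite inner distance.\<close>

definition inner_dist :: "'a::metric_space set \<Rightarrow> 'a \<Rightarrow> 'a \<Rightarrow> ennreal" where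
  "inner_dist Y x y =
     (INF g \<in> {g. path g \<and> path_image g \<subseteq> Y \<and> pathstart g = x \<and> pathfinish g = y}.
        curve_length g)"

text \<open>A set satisfying this is path-connected, because the bound makes all inner distances
  finite.\<close>

definition normally_embedded :: "'a::euclidean_space set \<Rightarrow> bool" where
  "normally_embedded Y \<longleftrightarrow>
     (\<exists>C>0. \<forall>x\<in>Y. \<forall>y\<in>Y. inner_dist Y x y \<le> ennreal (C * dist x y))"

text \<open>Neighbourhoods need not be open.\<close>

definition normally_embedded_at :: "'a::euclidean_space set \<Rightarrow> 'a \<Rightarrow> bool" where
  "normally_embedded_at Y x \<longleftrightarrow>
     x \<in> Y \<and> (\<exists>U. x \<in> interior U \<and> normally_embedded (U \<inter> Y))"

text \<open>The map \<open>e\<close> numbers the coordinates: the \<open>i\<close>-th coordinate of \<open>x\<close> is \<open>x $ e i\<close>,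
  for \<open>1 \<le> i \<le> n\<close>.\<close>

definition pham_brieskorn ::
    "nat \<Rightarrow> (nat \<Rightarrow> 'n::finite) \<Rightarrow> (nat \<Rightarrow> complex) \<Rightarrow> (nat \<Rightarrow> nat) \<Rightarrow> (complex ^ 'n) set" where
  "pham_brieskorn n e a k = {x. (\<Sum>i=1..n. a i * (x $ e i) ^ k i) = 0}"

end

theory Submission
  imports Defs
begin

text \<open>Put \<open>p = k 1\<close> and choose \<open>c\<close> with \<open>a 1 * c ^ p = - a 2\<close> and a \<open>p\<close>-th root of unity
  \<open>\<omega> \<noteq> 1\<close>. The points of \<open>X\<close> with first two coordinates \<open>(c s ^ k 2, s ^ p)\<close> and
  \<open>(c \<omega> s ^ k 2, s ^ p)\<close>, all others vanishing, are at distance \<open>O(s ^ k 2)\<close>. On a path in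
  \<open>X\<close> of length \<open>O(s ^ k 2)\<close> between them, \<open>x\<^sub>2 = s ^ p (1 + O(s))\<close> and
  \<open>x\<^sub>i ^ k i = O(s ^ (p * k 2 + 1))\<close> for \<open>i \<ge> 3\<close>, so that the equation of \<open>X\<close> keeps
  \<open>(x\<^sub>1 / (c s ^ k 2)) ^ p\<close> close to \<open>1\<close>. There the \<open>p\<close>-th root has \<open>p\<close> disjoint continuous
  branches, so the path cannot pass from the branch of \<open>1\<close> to that of \<open>\<omega>\<close>.\<close>

text \<open>The single segment between parameters \<open>0\<close> and \<open>u\<close> is an
  inscribed polygon, so the supremum dominates its length.\<close>

lemma dist_pathstart_le_curve_length:
  assumes "u \<in> {0..1}"
  shows "ennreal (dist (pathstart g) (g u)) \<le> curve_length g"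
proof -
  let ?t = "\<lambda>i::nat. if i = 0 then 0 else u"
  have "(1::nat, ?t) \<in> {(m, t). mono_on {..m} t \<and> t ` {..m} \<subseteq> {0..1}}"
    using assms by (auto simp: mono_on_def)
  from SUP_upper[OF this, of "\<lambda>(m, t). \<Sum>i<m. ennreal (dist (g (t i)) (g (t (Suc i))))"]
  show ?thesis
    unfolding curve_length_def by (simp add: pathstart_def)
qed

text \<open>The infimum in \<open>inner_dist\<close> need not be attained; raising \<open>C\<close>
  to \<open>C + 1\<close> leaves room for an actual path, as \<open>dist x y > 0\<close>. Its length
  then confines every point of it to a ball about \<open>x\<close>.\<close>

lemma short_path_in_normally_embedded:
  assumes C: "\<And>x y. x \<in> Y \<Longrightarrow> y \<in> Y \<Longrightarrow> inner_dist Y x y \<le> ennreal (C * dist x y)"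
    and "C > 0" "x \<in> Y" "y \<in> Y" "x \<noteq> y"
  obtains g where "path g" "path_image g \<subseteq> Y" "pathstart g = x" "pathfinish g = y"
    "\<And>u. u \<in> {0..1} \<Longrightarrow> dist x (g u) \<le> (C + 1) * dist x y"
proof -
  have "inner_dist Y x y \<le> ennreal (C * dist x y)"
    using assms by blast
  also have "\<dots> < ennreal ((C + 1) * dist x y)"
    using \<open>C > 0\<close> \<open>x \<noteq> y\<close> by (intro ennreal_lessI) auto
  finally obtain g where g: "path g" "path_image g \<subseteq> Y" "pathstart g = x" "pathfinish g = y"
    and len: "curve_length g < ennreal ((C + 1) * dist x y)"
    unfolding inner_dist_def INF_less_iff by blast
  have "dist x (g u) \<le> (C + 1) * dist x y" if "u \<in> {0..1}" for u
  proof -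
    have "ennreal (dist x (g u)) \<le> ennreal ((C + 1) * dist x y)"
      using dist_pathstart_le_curve_length[OF that, of g] g len by simp
    then show ?thesis
      using assms by (subst (asm) ennreal_le_iff) auto
  qed
  with g show thesis by (rule that)
qed

text \<open>The unit disc about \<open>1\<close> avoids the cut of \<open>Ln\<close>, so
  \<open>h\<close> is a continuous \<open>p\<close>-th root of \<open>z u ^ p\<close>. The quotient
  \<open>z / h\<close> is continuous with values in the finite set of \<open>p\<close>-th roots of
  unity, hence constant on the connected \<open>S\<close>.\<close>

lemma continuous_root_branch_unique:
  fixes z :: "'a::topological_space \<Rightarrow> complex"
  assumes "p > 0" "connected S" "continuous_on S z"
    and near: "\<And>u. u \<in> S \<Longrightarrow> norm (z u ^ p - 1) < 1"
    and "x \<in> S" "y \<in> S" "z x ^ p = 1" "z y ^ p = 1"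
  shows "z x = z y"
proof -
  define h where "h u = exp (Ln (z u ^ p) / of_nat p)" for u
  have slit: "z u ^ p \<notin> \<real>\<^sub>\<le>\<^sub>0" if "u \<in> S" for u
  proof
    assume "z u ^ p \<in> \<real>\<^sub>\<le>\<^sub>0"
    then have "Re (z u ^ p) \<le> 0"
      by (simp add: complex_nonpos_Reals_iff)
    then have "1 \<le> \<bar>Re (z u ^ p - 1)\<bar>" by simp
    also have "\<dots> < 1"
      using near[OF that] abs_Re_le_cmod[of "z u ^ p - 1"] by linarith
    finally show False by simp
  qed
  have hp: "h u ^ p = z u ^ p" if "u \<in> S" for u
  proof -
    have "z u ^ p \<noteq> 0" using slit[OF that] by (metis nonpos_Reals_zero_I)
    then show ?thesis
      using \<open>p > 0\<close> by (simp add: h_def flip: exp_of_nat_mult)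
  qed
  have cont: "continuous_on S (\<lambda>u. z u / h u)"
    unfolding h_def using slit assms by (intro continuous_intros) auto
  have "(\<lambda>u. z u / h u) ` S \<subseteq> {w. w ^ p = 1}"
  proof clarify
    fix u assume "u \<in> S"
    have "h u \<noteq> 0" by (simp add: h_def)
    then show "(z u / h u) ^ p = 1"
      using hp[OF \<open>u \<in> S\<close>] by (metis divide_self power_divide power_not_zero)
  qed
  moreover have "finite {w::complex. w ^ p = 1}"
    using \<open>p > 0\<close> by (intro finite_roots_unity) auto
  ultimately have "finite ((\<lambda>u. z u / h u) ` S)"
    by (rule finite_subset)
  then have "(\<lambda>u. z u / h u) constant_on S"
    using continuous_finite_range_constant[OF \<open>connected S\<close> cont] by blast
  then have "z x / h x = z y / h y"
    using assms unfolding constant_on_def by metis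
  \<comment> \<open>Where \<open>z u ^ p = 1\<close>, the principal root \<open>h u\<close> is
    \<open>exp 0 = 1\<close>.\<close>
  then show ?thesis
    using assms by (simp add: h_def)
qed

lemma eventually_mult_less_at_right_0:
  fixes A b :: real
  assumes "b > 0"
  shows "\<forall>\<^sub>F s in at_right 0. A * s < b"
proof -
  have "((\<lambda>s. A * s) \<longlongrightarrow> A * 0) (at_right 0)"
    by (intro tendsto_intros)
  then show ?thesis
    using assms by (auto dest: order_tendstoD(2))
qed

lemma nontrivial_root_of_unity:
  assumes "p > 1"
  obtains w :: complex where "w ^ p = 1" "w \<noteq> 1"
proof
  have p: "p > 0" using assms by simp
  show "cis (2 * pi / p) ^ p = 1"
    using p by (simp add: Complex.DeMoivre)
  show "cis (2 * pi / p) \<noteq> 1"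
  proof
    assume "cis (2 * pi / p) = 1"
    then have "cos (2 * pi / p) = 1" by (simp add: complex_eq_iff)
    then obtain m :: int where m: "2 * pi / p = of_int m * 2 * pi"
      using cos_one_2pi_int[of "2 * pi / p"] by blast
    then have "of_int m * real p = of_int 1" using p by (simp add: field_simps)
    then have "m * int p = 1" by (metis of_int_eq_iff of_int_mult of_int_of_nat_eq)
    then show False using assms by (simp add: zmult_eq_1_iff)
  qed
qed

lemma norm_axis: "norm (axis i x) = norm (x :: 'a::real_inner)"
  by (simp add: norm_eq_sqrt_inner inner_axis_axis)

lemma complex_root_exists:
  fixes v :: complex
  assumes "v \<noteq> 0" "p > 0"
  obtains c where "c ^ p = v" "c \<noteq> 0"
proof
  show "exp (Ln v / of_nat p) ^ p = v"
    using assms by (simp flip: exp_of_nat_mult)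
qed simp

theorem corollary4p3:
  fixes n :: nat
    and e :: "nat \<Rightarrow> 'n::finite"
    and a :: "nat \<Rightarrow> complex"
    and k :: "nat \<Rightarrow> nat"
  assumes "n \<ge> 2"
    and "bij_betw e {1..n} (UNIV :: 'n set)"
    and "\<And>i. i \<in> {1..n} \<Longrightarrow> a i \<noteq> 0"
    and "1 < k 1" and "k 1 < k 2"
    and "\<And>i. 2 \<le> i \<Longrightarrow> i < n \<Longrightarrow> k i \<le> k (Suc i)"
  shows "\<not> normally_embedded_at (pham_brieskorn n e a k) 0"
proof
  let ?X = "pham_brieskorn n e a k"
  define p where "p = k 1"
  define q where "q = k 2"
  have p: "p > 1" and pq: "p < q" using assms by (auto simp: p_def q_def)
  have k_ge: "q \<le> k i" if "2 \<le> i" "i \<le> n" for i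
    using that(1,2)
  proof (induction i rule: dec_induct)
    case base then show ?case by (simp add: q_def)
  next
    case (step i) then show ?case using assms(6)[of i] by simp
  qed
  have inj: "e i = e j \<longleftrightarrow> i = j" if "i \<in> {1..n}" "j \<in> {1..n}" for i j
    using assms(2) that by (auto simp: bij_betw_def inj_on_eq_iff)
  have a1: "a 1 \<noteq> 0" and a2: "a 2 \<noteq> 0" using assms(1,3) by auto
  have split: "(\<Sum>i=1..n. f i) = f 1 + f 2 + (\<Sum>i=3..n. f i)" for f :: "nat \<Rightarrow> complex"
    using assms(1) by (simp add: sum.atLeast_Suc_atMost numeral_2_eq_2 numeral_3_eq_3)

  assume "normally_embedded_at ?X 0"
  then obtain U C where U: "0 \<in> interior U" and "C > 0"
    and C: "\<And>x y. x \<in> U \<inter> ?X \<Longrightarrow> y \<in> U \<inter> ?X \<Longrightarrow>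
      inner_dist (U \<inter> ?X) x y \<le> ennreal (C * dist x y)"
    unfolding normally_embedded_at_def normally_embedded_def by blast
  obtain r where r: "r > 0" "ball 0 r \<subseteq> U"
    using U by (auto simp: mem_interior)
  obtain c where c: "c ^ p = - a 2 / a 1" "c \<noteq> 0"
    using complex_root_exists[of "- a 2 / a 1" p] a1 a2 p by auto
  obtain w :: complex where w: "w ^ p = 1" "w \<noteq> 1"
    using nontrivial_root_of_unity[OF p] .
  have "norm w ^ p = 1 ^ p"
    using w by (simp flip: norm_power)
  then have norm_w: "norm w = 1"
    using p by (subst (asm) power_eq_iff_eq_base) auto
  \<comment> \<open>The endpoints will be \<open>norm (c - c * w) * s ^ q\<close> apart, so
    \<open>K * s ^ q\<close> bounds the displacement along the path.\<close>
  define K where "K = (C + 1) * norm (c - c * w)"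
  have "K > 0" using c w \<open>C > 0\<close> by (simp add: K_def)
  have "isCont (\<lambda>y::complex. y ^ q) 1" by simp
  \<comment> \<open>The deviation of \<open>z u ^ p\<close> from \<open>1\<close> is split in two:
    one half for the second coordinate, controlled by \<open>\<delta>\<close>, the other for the
    coordinates from the third on, controlled by \<open>B\<close>.\<close>
  then obtain \<delta> where \<delta>: "\<delta> > 0"
    "\<And>y::complex. norm (y - 1) < \<delta> \<Longrightarrow> norm (y ^ q - 1) < 1 / 2"
    using continuous_at_eps_delta[of 1 "\<lambda>y::complex. y ^ q"]
    by (metis dist_norm power_one zero_less_divide_1_iff zero_less_numeral)
  define B where "B = (\<Sum>i=3..n. norm (a i / a 2) * K ^ k i)"
  \<comment> \<open>The bound by \<open>r\<close> puts the endpoints into \<open>U\<close>; the last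
    two bounds give the two halves.\<close>
  have "\<forall>\<^sub>F s in at_right 0. 0 < s \<and> 1 * s < 1 \<and> (norm c + 1) * s < r \<and> K * s < \<delta> \<and> B * s < 1 / 2"
    using r \<delta> by (intro eventually_conj eventually_mult_less_at_right_0 eventually_at_right_less) auto
  then obtain s :: real where s: "0 < s" "s < 1" "(norm c + 1) * s < r" "K * s < \<delta>" "B * s < 1 / 2"
    using eventually_happens'[OF trivial_limit_at_right_real] unfolding mult_1 by blast
  have s_pow: "s ^ m \<le> s" if "m > 0" for m
    using power_decreasing[of 1 m s] s that by simp

  define P where "P v = axis (e 1) (v * of_real (s ^ q)) + axis (e 2) (of_real (s ^ p))" for v :: complex
  have P_nth: "P v $ e i = (if i = 1 then v * of_real (s ^ q) else if i = 2 then of_real (s ^ p) else 0)"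
    if "i \<in> {1..n}" for v i
    using that assms(1) by (auto simp: P_def axis_def inj)
  have P_mem: "P v \<in> U \<inter> ?X" if "v ^ p = c ^ p" "norm v = norm c" for v
  proof
    have "norm (P v) \<le> norm v * s ^ q + s ^ p"
      unfolding P_def using s by (intro norm_triangle_le) (simp add: norm_axis norm_mult norm_power)
    also have "\<dots> \<le> norm c * s + s"
      using p pq that by (intro add_mono mult_mono s_pow) (auto simp: s less_imp_le)
    finally show "P v \<in> U" using s r by (auto simp: algebra_simps subset_iff)
    \<comment> \<open>The exponents must be positive here, since \<open>0 ^ 0 = 1\<close>.\<close>
    have "(\<Sum>i=3..n. a i * (P v $ e i) ^ k i) = 0"
    proof (rule sum.neutral, rule ballI)
      fix i assume "i \<in> {3..n}"
      then show "a i * (P v $ e i) ^ k i = 0"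
        using k_ge[of i] pq P_nth[of i v] by auto
    qed
    then have "(\<Sum>i=1..n. a i * (P v $ e i) ^ k i) =
        a 1 * (v * of_real (s ^ q)) ^ p + a 2 * of_real (s ^ p) ^ q"
      unfolding split using assms(1) P_nth[of 1 v] P_nth[of 2 v] by (simp add: p_def q_def)
    also have "\<dots> = (a 1 * v ^ p + a 2) * of_real (s ^ (p * q))"
      by (simp add: power_mult_distrib algebra_simps flip: power_mult)
    also have "a 1 * v ^ p + a 2 = 0"
      using a1 that c by simp
    finally have "(\<Sum>i=1..n. a i * (P v $ e i) ^ k i) = 0" by simp
    then show "P v \<in> ?X" by (simp add: pham_brieskorn_def)
  qed
  have dist_P: "dist (P v) (P v') = norm (v - v') * s ^ q" for v v'
  proof -
    have "P v - P v' = axis (e 1) ((v - v') * of_real (s ^ q))"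
      by (simp add: P_def vec_eq_iff axis_def algebra_simps)
    then show ?thesis using s by (simp add: dist_norm norm_axis norm_mult norm_power)
  qed
  have "P c \<noteq> P (c * w)"
    using dist_P[of c "c * w"] c w s by auto
  moreover have "P c \<in> U \<inter> ?X" "P (c * w) \<in> U \<inter> ?X"
    using P_mem w norm_w by (auto simp: power_mult_distrib norm_mult)
  ultimately obtain g where g: "path g" "path_image g \<subseteq> U \<inter> ?X"
      "pathstart g = P c" "pathfinish g = P (c * w)"
    and g_near': "\<And>u. u \<in> {0..1} \<Longrightarrow> dist (P c) (g u) \<le> (C + 1) * dist (P c) (P (c * w))"
    using short_path_in_normally_embedded[OF C \<open>C > 0\<close>, of "P c" "P (c * w)"] by auto
  have g_near: "norm (g u $ j - P c $ j) \<le> K * s ^ q" if "u \<in> {0..1}" for u j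
    using g_near'[OF that] Finite_Cartesian_Product.norm_nth_le[of "g u - P c" j]
    unfolding dist_P K_def by (simp add: dist_norm norm_minus_commute mult.assoc)

  \<comment> \<open>Rescaling the first coordinate turns its values at the endpoints into
    \<open>1\<close> and \<open>w\<close>.\<close>
  define z where "z u = g u $ e 1 / (c * of_real (s ^ q))" for u
  have "norm (z u ^ p - 1) < 1" if u: "u \<in> {0..1}" for u
  proof -
    let ?x = "\<lambda>i. g u $ e i"
    have "g u \<in> ?X" using g u by (auto simp: path_image_def)
    then have "a 1 * ?x 1 ^ p + a 2 * ?x 2 ^ q + (\<Sum>i=3..n. a i * ?x i ^ k i) = 0"
      unfolding pham_brieskorn_def mem_Collect_eq split by (simp add: p_def q_def)
    then have eq: "- (a 1 * ?x 1 ^ p) = a 2 * ?x 2 ^ q + (\<Sum>i=3..n. a i * ?x i ^ k i)"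
      by (simp add: add_eq_0_iff add.assoc)
    \<comment> \<open>By the choice of \<open>c\<close>, this is the equation of \<open>X\<close>
      divided by \<open>a 2 * s ^ (p * q)\<close> and solved for the first term.\<close>
    have "z u ^ p = ?x 1 ^ p / (c ^ p * of_real (s ^ (p * q)))"
      by (simp add: z_def power_divide power_mult_distrib mult.commute flip: power_mult)
    also have "\<dots> = - (a 1 * ?x 1 ^ p) / (a 2 * of_real (s ^ (p * q)))"
      unfolding c(1) using a1 a2 s by (simp add: field_simps)
    also have "\<dots> = (?x 2 / of_real (s ^ p)) ^ q +
        (\<Sum>i=3..n. a i / a 2 * (?x i ^ k i / of_real (s ^ (p * q))))"
      unfolding eq using a2 s
      by (simp add: add_divide_distrib sum_divide_distrib power_divide flip: power_mult)
    finally have zp: "z u ^ p - 1 = ((?x 2 / of_real (s ^ p)) ^ q - 1) +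
        (\<Sum>i=3..n. a i / a 2 * (?x i ^ k i / of_real (s ^ (p * q))))"
      by simp
    have "norm (?x 2 / of_real (s ^ p) - 1) = norm (?x 2 - of_real (s ^ p)) / s ^ p"
    proof -
      have "?x 2 / of_real (s ^ p) - 1 = (?x 2 - of_real (s ^ p)) / of_real (s ^ p)"
        using s by (simp add: diff_divide_distrib)
      then show ?thesis using s by (simp add: norm_divide norm_power)
    qed
    also have "\<dots> \<le> K * s ^ q / s ^ p"
      using g_near[OF u, of "e 2"] P_nth[of 2 c] assms(1) s by (intro divide_right_mono) auto
    \<comment> \<open>Here \<open>p < q\<close> leaves at least one factor \<open>s\<close>.\<close>
    also have "\<dots> = K * s ^ (q - p)"
      using s pq by (simp add: power_diff)
    also have "\<dots> \<le> K * s"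
      using \<open>K > 0\<close> pq by (intro mult_left_mono s_pow) auto
    also have "\<dots> < \<delta>" by fact
    finally have main: "norm ((?x 2 / of_real (s ^ p)) ^ q - 1) < 1 / 2"
      by (rule \<delta>)
    have "norm (\<Sum>i=3..n. a i / a 2 * (?x i ^ k i / of_real (s ^ (p * q)))) \<le>
        (\<Sum>i=3..n. norm (a i / a 2) * K ^ k i * s)"
    proof (rule sum_norm_le)
      fix i assume i: "i \<in> {3..n}"
      have ki: "p < k i" using k_ge[of i] i pq by auto
      have "norm (?x i) \<le> K * s ^ q"
        using g_near[OF u, of "e i"] P_nth[of i c] i by auto
      then have "norm (?x i) ^ k i \<le> (K * s ^ q) ^ k i"
        by (intro power_mono) auto
      then have "norm (?x i ^ k i / of_real (s ^ (p * q))) \<le> (K * s ^ q) ^ k i / s ^ (p * q)"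
        using s by (simp add: norm_divide norm_power divide_right_mono)
      \<comment> \<open>The exponent is \<open>q * (k i - p)\<close>, positive because
        \<open>k i \<ge> q > p\<close>.\<close>
      also have "\<dots> = K ^ k i * s ^ (q * k i - p * q)"
        using s ki by (subst power_diff) (auto simp: power_mult_distrib mult.commute simp flip: power_mult)
      also have "\<dots> \<le> K ^ k i * s"
        using \<open>K > 0\<close> ki pq by (intro mult_left_mono s_pow) (auto simp: mult.commute)
      finally show "norm (a i / a 2 * (?x i ^ k i / of_real (s ^ (p * q)))) \<le>
          norm (a i / a 2) * K ^ k i * s"
        unfolding norm_mult mult.assoc by (intro mult_left_mono) auto
    qed
    also have "\<dots> = B * s" by (simp add: B_def sum_distrib_right)
    also have "\<dots> < 1 / 2" by fact
    finally show ?thesis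
      unfolding zp using main by (intro norm_triangle_lt) auto
  qed
  moreover have "continuous_on {0..1} z"
    unfolding z_def using g(1) c s by (intro continuous_intros) (auto simp: path_def)
  moreover have "z 0 = 1" "z 1 = w"
    using g(3,4) P_nth[of 1] assms(1) c s by (auto simp: z_def pathstart_def pathfinish_def)
  \<comment> \<open>Both \<open>1\<close> and \<open>w\<close> are \<open>p\<close>-th roots of
    \<open>1\<close>, so they would lie on the same branch.\<close>
  ultimately have "1 = w"
    using continuous_root_branch_unique[of p "{0..1::real}" z 0 1] w p by simp
  with w show False by simp
qed

end
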